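(* Let $n\ge1$, let $s_1,s_2$ be non-negative integers and $x_1,x_2\in\mathbb{C}$. Let $D$ be the group of $n\times n$ diagonal matrices with diagonal entries in $\{1,-1\}$, identify $\mathcal{S}_n$ with the group of $n\times n$ permutation matrices, let $\mathcal{W}_n:=D\mathcal{S}_n$, and for $w\in\mathcal{W}_n$ let $Z_{\mathcal{W}_n}(x)(w):=\det(I-xw)$. Then, for $w$ uniformly distributed on $\mathcal{W}_n$, $$\mathbb{E}\left[Z_{\mathcal{W}_n}^{s_1}(x_1)Z_{\mathcal{W}_n}^{s_2}(x_2)\right]=\left[\prod_{\substack{k_1,k_2=0\\2\mid(k_1-k_2)}}^\infty(1-x_1^{k_1}x_2^{k_2}t)^{\binom{s_1}{k_1}\binom{s_2}{k_2}(-1)^{k_1+k_2+1}}\right]_n.$$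
   Context: For a power series $h(t)=\sum_n h_nt^n$ write $[h(t)]_n:=h_n$; the product is finite since $\binom{s}{k}=0$ for $k>s$, and is expanded as a power series in $t$ at $0$. $\mathcal{S}_n$ is the symmetric group on $n$ points, embedded by $\sigma\mapsto(\delta_{i,\sigma(j)})_{1\le i,j\le n}$. *)

theory Defs
  imports
    "HOL-Probability.Probability_Mass_Function"
    "HOL-Library.Groups_Big_Fun"
    "HOL-Computational_Algebra.Formal_Power_Series"
    "HOL-Combinatorics.Permutations"
    "Jordan_Normal_Form.Determinant"
begin

text \<open>Matrices are those of \<open>Jordan_Normal_Form\<close>, with row and column indices \<open>0, \<dots>, n - 1\<close>
  in place of \<open>1, \<dots>, n\<close>. Both that entry and \<open>HOL-Analysis\<close> provide a constant \<open>det\<close>,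
  so the one intended here is always qualified.\<close>

definition sign_diagonal_matrices :: "nat \<Rightarrow> complex mat set" where
  "sign_diagonal_matrices n =
     {d \<in> carrier_mat n n. diagonal_mat d \<and> (\<forall>i<n. d $$ (i, i) \<in> {1, -1})}"

definition permutation_matrix :: "nat \<Rightarrow> (nat \<Rightarrow> nat) \<Rightarrow> complex mat" where
  "permutation_matrix n \<sigma> = mat n n (\<lambda>(i, j). if i = \<sigma> j then 1 else 0)"

definition permutation_matrices :: "nat \<Rightarrow> complex mat set" where
  "permutation_matrices n = permutation_matrix n ` {\<sigma>. \<sigma> permutes {0..<n}}"

definition hyperoctahedral_group :: "nat \<Rightarrow> complex mat set" where
  "hyperoctahedral_group n =
     {d * p | d p. d \<in> sign_diagonal_matrices n \<and> p \<in> permutation_matrices n}"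

definition char_poly_value :: "nat \<Rightarrow> complex \<Rightarrow> complex mat \<Rightarrow> complex" where
  "char_poly_value n x w = Determinant.det (1\<^sub>m n - x \<cdot>\<^sub>m w)"

text \<open>The factor of the infinite product indexed by \<open>(k\<^sub>1, k\<^sub>2)\<close>, as a formal power series in
  \<open>t\<close>. Its base has constant term \<open>1\<close>, so the
  negative integer power is formed with the genuine inverse power series.\<close>

definition product_factor ::
  "nat \<Rightarrow> nat \<Rightarrow> complex \<Rightarrow> complex \<Rightarrow> nat \<Rightarrow> nat \<Rightarrow> complex fps" where
  "product_factor s1 s2 x1 x2 k1 k2 =
     (1 - fps_const (x1 ^ k1 * x2 ^ k2) * fps_X) powi
       (int (s1 choose k1) * int (s2 choose k2) * (-1) ^ (k1 + k2 + 1))"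

text \<open>Only finitely many factors differ from \<open>1\<close>, so \<^const>\<open>Prod_any\<close> (which would default
  to \<open>1\<close> on infinite support) yields the intended product.\<close>

lemma finite_product_factor_support:
  "finite {(k1, k2). product_factor s1 s2 x1 x2 k1 k2 \<noteq> 1}"
proof (rule finite_subset)
  show "{(k1, k2). product_factor s1 s2 x1 x2 k1 k2 \<noteq> 1} \<subseteq> {..s1} \<times> {..s2}"
    by (auto simp: product_factor_def) (metis binomial_eq_0 linorder_not_le mult_zero_left
        mult_zero_right minus_zero of_nat_0 power_int_0_right)+
qed simp

lemma product_factor_times_base:
  assumes "even (int k1 - int k2)"
  shows "product_factor s1 s2 x1 x2 k1 k2 *
     (1 - fps_const (x1 ^ k1 * x2 ^ k2) * fps_X) ^ ((s1 choose k1) * (s2 choose k2)) = 1"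
proof -
  let ?b = "1 - fps_const (x1 ^ k1 * x2 ^ k2) * fps_X :: complex fps"
  have e: "(-1::int) ^ (k1 + k2 + 1) = -1"
    using assms by simp
  have "?b powi (- int m) * ?b ^ m = 1" for m
    by (cases "m = 0")
       (auto simp: power_int_def nat_eq_iff inverse_mult_eq_1 simp flip: power_mult_distrib)
  from this[of "(s1 choose k1) * (s2 choose k2)"] show ?thesis
    unfolding product_factor_def e by simp
qed

end

theory Submission
  imports Defs
begin

text \<open>Write an element of the group as a pair of signs \<open>\<epsilon>\<close> and a permutation \<open>\<sigma>\<close>. Expanding
  \<open>det (I - x w)\<close> by the Leibniz formula and splitting off the identity leaves one term for each
  \<open>\<sigma>\<close>-invariant set \<open>S\<close> of indices, namely \<open>sign (\<sigma>|S)\<close> times the product of \<open>- x \<epsilon>\<^sub>i\<close> over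
  \<open>i \<in> S\<close> (\<open>char_poly_value_signed_permutation_matrix\<close>). A product of such determinants, with
  variables \<open>X\<^sub>j\<close> for \<open>j \<in> J\<close>, is a sum over families of invariant sets, or equivalently over
  the colourings \<open>f\<close> of the indices by subsets of \<open>J\<close> that satisfy \<open>f \<circ> \<sigma> = f\<close>
  (\<open>prod_char_poly_value_signed_permutation_matrix\<close>).

  Averaging over \<open>\<epsilon>\<close> kills every colouring that uses a set of odd size (\<open>sum_signs_prod\<close>). For
  the others all signs cancel: the product of the restrictions of \<open>\<sigma>\<close> to the invariant sets
  is the permutation \<open>i \<mapsto> \<sigma>\<^sup>m i\<close> with \<open>m = card (f i)\<close>, which is a square when all these
  numbers are even (\<open>sign_pointwise_power_even\<close>). What remains is the sum over \<open>\<sigma>\<close>, and over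
  colourings \<open>f\<close> fixed by \<open>\<sigma>\<close>, of the product of the weights \<open>Y (f i)\<close>, where \<open>Y T\<close> is the
  product of the \<open>X\<^sub>j\<close> with \<open>j \<in> T\<close>. Summing over \<open>\<sigma>\<close> first gives the order of the stabiliser of
  \<open>f\<close>, a product of factorials, and the sum becomes \<open>n!\<close> times the complete homogeneous symmetric
  polynomial of degree \<open>n\<close> in the weights, the coefficient of \<open>t\<^sup>n\<close> in the product of the series
  \<open>1 / (1 - Y T t)\<close> over the subsets \<open>T\<close> of \<open>J\<close> of even size
  (\<open>sum_permutations_fixed_colourings\<close>). The theorem is the case where \<open>J\<close>
  consists of \<open>s\<^sub>1\<close> indices with variable \<open>x\<^sub>1\<close> and \<open>s\<^sub>2\<close> indices with variable \<open>x\<^sub>2\<close>, after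
  grouping the sets \<open>T\<close> by the sizes of their two parts.\<close>

section \<open>Pointwise powers of a permutation\<close>

text \<open>The map that applies \<open>\<sigma>\<close> to \<open>i\<close> as many times as \<open>m i\<close> says. When \<open>m\<close> is constant on the
  cycles of \<open>\<sigma>\<close>, it is a permutation that raises each cycle to its own power. With \<open>m\<close> the indicator
  of an invariant set, it is \<open>\<sigma>\<close> on that set and the identity elsewhere.\<close>

definition pointwise_power :: "('a \<Rightarrow> 'a) \<Rightarrow> ('a \<Rightarrow> nat) \<Rightarrow> 'a \<Rightarrow> 'a" where
  "pointwise_power \<sigma> m i = (\<sigma> ^^ m i) i"

lemma funpow_invariant:
  assumes "\<And>i. m (\<sigma> i) = m i"
  shows "m ((\<sigma> ^^ k) i) = m i"
  by (induction k) (simp_all add: assms)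

lemma funpow_permutes:
  assumes "\<sigma> permutes A"
  shows "(\<sigma> ^^ k) permutes A"
proof (induction k)
  case (Suc k)
  then show ?case
    using permutes_compose[OF Suc assms] by (simp only: funpow.simps)
qed (simp add: permutes_id[unfolded id_def])

lemma pointwise_power_add:
  assumes "\<And>i. m (\<sigma> i) = m i"
  shows "pointwise_power \<sigma> (\<lambda>i. k i + m i) = pointwise_power \<sigma> m \<circ> pointwise_power \<sigma> k"
proof
  fix i
  have "(\<sigma> ^^ (k i + m i)) i = (\<sigma> ^^ (m i + k i)) i"
    by (simp add: add.commute)
  then show "pointwise_power \<sigma> (\<lambda>i. k i + m i) i = (pointwise_power \<sigma> m \<circ> pointwise_power \<sigma> k) i"
    by (simp add: pointwise_power_def funpow_add funpow_invariant[of m, OF assms])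
qed

lemma pointwise_power_permutes:
  assumes \<sigma>: "\<sigma> permutes A" and A: "finite A" and inv: "\<And>i. m (\<sigma> i) = m i"
  shows "pointwise_power \<sigma> m permutes A"
proof (rule inj_imp_permutes[OF _ A])
  have perm: "(\<sigma> ^^ k) permutes A" for k
    using \<sigma> by (rule funpow_permutes)
  show "inj_on (pointwise_power \<sigma> m) A"
  proof (rule inj_onI)
    fix i j
    assume eq: "pointwise_power \<sigma> m i = pointwise_power \<sigma> m j"
    then have "m ((\<sigma> ^^ m i) i) = m ((\<sigma> ^^ m j) j)"
      by (simp add: pointwise_power_def)
    then have "m i = m j"
      by (simp only: funpow_invariant[of m, OF inv])
    with eq have "(\<sigma> ^^ m i) i = (\<sigma> ^^ m i) j"
      by (simp add: pointwise_power_def)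
    then show "i = j"
      using permutes_inj[OF perm, of "m i"] by (simp add: inj_eq)
  qed
  show "pointwise_power \<sigma> m i \<in> A" if "i \<in> A" for i
    using permutes_in_image[OF perm] that by (simp add: pointwise_power_def)
  show "pointwise_power \<sigma> m i = i" if "i \<notin> A" for i
    using permutes_not_in[OF perm that] by (simp add: pointwise_power_def)
qed

lemma sign_pointwise_power_add:
  assumes "\<sigma> permutes A" "finite A" "\<And>i. m (\<sigma> i) = m i" "\<And>i. k (\<sigma> i) = k i"
  shows "sign (pointwise_power \<sigma> (\<lambda>i. k i + m i)) =
    sign (pointwise_power \<sigma> k) * sign (pointwise_power \<sigma> m)"
  unfolding pointwise_power_add[of m, OF assms(3)]
  by (subst sign_compose)
    (use assms in \<open>auto intro!: permutes_imp_permutation pointwise_power_permutes\<close>)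

lemma sign_pointwise_power_sum:
  assumes "\<sigma> permutes A" "finite A" "finite J" "\<And>j i. j \<in> J \<Longrightarrow> m j (\<sigma> i) = m j i"
  shows "sign (pointwise_power \<sigma> (\<lambda>i. \<Sum>j\<in>J. m j i)) = (\<Prod>j\<in>J. sign (pointwise_power \<sigma> (m j)))"
  using assms(3,4)
proof (induction J rule: finite_induct)
  case empty
  have "pointwise_power \<sigma> (\<lambda>i. 0) = id"
    by (auto simp: pointwise_power_def)
  then show ?case by simp
next
  case (insert j J)
  have inv: "(\<Sum>j\<in>J. m j (\<sigma> i)) = (\<Sum>j\<in>J. m j i)" for i
    using insert.prems by (intro sum.cong) auto
  then have "sign (pointwise_power \<sigma> (\<lambda>i. m j i + (\<Sum>j\<in>J. m j i))) =
      sign (pointwise_power \<sigma> (m j)) * sign (pointwise_power \<sigma> (\<lambda>i. \<Sum>j\<in>J. m j i))"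
    using insert.prems by (intro sign_pointwise_power_add[OF assms(1,2)]) auto
  then show ?case
    using insert by simp
qed

text \<open>With even exponents the map is the square of the one with halved exponents.\<close>

lemma sign_pointwise_power_even:
  assumes \<sigma>: "\<sigma> permutes A" "finite A" and inv: "\<And>i. m (\<sigma> i) = m i"
    and even: "\<And>i. i \<in> A \<Longrightarrow> even (m i)"
  shows "sign (pointwise_power \<sigma> m) = 1"
proof -
  have "pointwise_power \<sigma> m = pointwise_power \<sigma> (\<lambda>i. m i div 2 + m i div 2)"
  proof
    fix i
    show "pointwise_power \<sigma> m i = pointwise_power \<sigma> (\<lambda>i. m i div 2 + m i div 2) i"
    proof (cases "i \<in> A")
      case True
      then have "m i = m i div 2 + m i div 2"
        using even by fastforce
      then show ?thesis by (simp add: pointwise_power_def)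
    next
      case False
      then have "(\<sigma> ^^ k) i = i" for k
        using permutes_not_in funpow_permutes \<sigma>(1) by metis
      then show ?thesis by (simp add: pointwise_power_def)
    qed
  qed
  moreover have "sign (pointwise_power \<sigma> (\<lambda>i. m i div 2 + m i div 2)) =
      sign (pointwise_power \<sigma> (\<lambda>i. m i div 2)) * sign (pointwise_power \<sigma> (\<lambda>i. m i div 2))"
    using inv by (intro sign_pointwise_power_add[OF \<sigma>]) simp_all
  ultimately show ?thesis by simp
qed

section \<open>The characteristic polynomial of a monomial matrix\<close>

text \<open>The product of the diagonal matrix with entries \<open>\<epsilon> i\<close> and the permutation matrix of \<open>\<sigma>\<close>. The
  entries \<open>\<epsilon> i\<close> are arbitrary here; they are restricted to \<open>1\<close> and \<open>-1\<close> only for the average.\<close>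

definition signed_permutation_matrix :: "nat \<Rightarrow> (nat \<Rightarrow> complex) \<Rightarrow> (nat \<Rightarrow> nat) \<Rightarrow> complex mat" where
  "signed_permutation_matrix n \<epsilon> \<sigma> = mat n n (\<lambda>(i, j). if i = \<sigma> j then \<epsilon> i else 0)"

text \<open>A permutation that agrees with \<open>\<sigma>\<close> on \<open>S\<close> and is the identity off \<open>S\<close> can exist only if \<open>S\<close> is
  invariant under \<open>\<sigma>\<close>. Hence each set \<open>S\<close> contributes at most one permutation to the Leibniz
  expansion.\<close>

lemma permutes_restriction_unique:
  assumes \<sigma>: "\<sigma> permutes A" and A: "finite A" and S: "S \<subseteq> A" and p: "p permutes A"
    and on: "\<And>i. i \<in> S \<Longrightarrow> p i = \<sigma> i" and off: "\<And>i. i \<in> A - S \<Longrightarrow> p i = i"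
  shows "(\<sigma> i \<in> S) = (i \<in> S)" "p = pointwise_power \<sigma> (\<lambda>i. of_bool (i \<in> S))"
proof -
  have fixed: "p i = i" if "i \<notin> S" for i
    using that off permutes_not_in[OF p] by blast
  have "p ` S \<subseteq> S"
  proof
    fix y assume "y \<in> p ` S"
    then obtain i where i: "i \<in> S" "y = p i" by blast
    show "y \<in> S"
    proof (rule ccontr)
      assume "y \<notin> S"
      then have "p y = y" by (rule fixed)
      then have "y = i" using i injD[OF permutes_inj[OF p]] by metis
      with i \<open>y \<notin> S\<close> show False by simp
    qed
  qed
  moreover have "finite S" using A S finite_subset by blast
  ultimately have "p ` S = S"
    using endo_inj_surj permutes_inj_on[OF p] by metis
  then have "\<sigma> ` S = S" using on by force
  then show "(\<sigma> i \<in> S) = (i \<in> S)"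
    using inj_image_mem_iff[OF permutes_inj[OF \<sigma>]] by metis
  show "p = pointwise_power \<sigma> (\<lambda>i. of_bool (i \<in> S))"
    using on fixed by (fastforce simp: pointwise_power_def)
qed

text \<open>The summand of \<open>S\<close> is \<open>(- x) ^ card S\<close> times the principal minor of the matrix with index set
  \<open>S\<close>; the minors of sets that are not invariant vanish.\<close>

lemma char_poly_value_signed_permutation_matrix:
  fixes x :: complex
  assumes \<sigma>: "\<sigma> permutes {0..<n}"
  shows "char_poly_value n x (signed_permutation_matrix n \<epsilon> \<sigma>) =
    (\<Sum>S | S \<subseteq> {0..<n} \<and> (\<forall>i. (\<sigma> i \<in> S) = (i \<in> S)).
      of_int (sign (pointwise_power \<sigma> (\<lambda>i. of_bool (i \<in> S)))) * (\<Prod>i\<in>S. - (x * \<epsilon> i)))"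
proof -
  define A where "A = {0..<n}"
  define W where "W = signed_permutation_matrix n \<epsilon> \<sigma>"
  define P where "P = {p. p permutes A}"
  let ?r = "\<lambda>S. pointwise_power \<sigma> (\<lambda>i. of_bool (i \<in> S))"
  let ?inv = "\<lambda>S. \<forall>i. (\<sigma> i \<in> S) = (i \<in> S)"
  note \<sigma>A = \<sigma>[folded A_def]
  have finA: "finite A" and finP: "finite P"
    by (simp_all add: A_def P_def finite_permutations)
  have W: "1\<^sub>m n - x \<cdot>\<^sub>m W \<in> carrier_mat n n"
    by (auto simp: W_def signed_permutation_matrix_def intro!: minus_carrier_mat)
  \<comment> \<open>The expansion is taken along columns, so that the condition is \<open>p i = \<sigma> i\<close> and not
    \<open>p i = inv \<sigma> i\<close>; this replaces \<open>\<epsilon> i\<close> by \<open>\<epsilon> (\<sigma> i)\<close>, which is harmless in products over invariant sets.\<close>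
  let ?b = "\<lambda>p i. - (if p i = \<sigma> i then x * \<epsilon> (\<sigma> i) else 0)"
  let ?a = "\<lambda>p i. if p i = i then 1 else 0 :: complex"
  have entry: "(1\<^sub>m n - x \<cdot>\<^sub>m W) $$ (p j, j) = ?b p j + ?a p j" if "p \<in> P" "j \<in> A" for p j
    using that permutes_in_image[of p A j] by (auto simp: W_def signed_permutation_matrix_def A_def P_def)
  have "char_poly_value n x W = (\<Sum>p\<in>P. of_int (sign p) * (\<Prod>j\<in>A. ?b p j + ?a p j))"
    unfolding char_poly_value_def Determinant.det_col[OF W] P_def[symmetric] A_def[symmetric]
    using entry by (intro sum.cong refl arg_cong2[of _ _ _ _ "(*)"])
      (auto simp: A_def lessThan_atLeast0 intro!: prod.cong)
  also have "\<dots> = (\<Sum>p\<in>P. \<Sum>S\<in>Pow A. of_int (sign p) * (prod (?b p) S * prod (?a p) (A - S)))"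
    unfolding prod_add[OF finA] sum_distrib_left ..
  also have "\<dots> = (\<Sum>S\<in>Pow A. \<Sum>p\<in>P. of_int (sign p) * (prod (?b p) S * prod (?a p) (A - S)))"
    by (rule sum.swap)
  also have "\<dots> = (\<Sum>S\<in>Pow A. if ?inv S then of_int (sign (?r S)) * (\<Prod>i\<in>S. - (x * \<epsilon> i)) else 0)"
  proof (rule sum.cong[OF refl])
    fix S assume "S \<in> Pow A"
    then have S: "S \<subseteq> A" by simp
    then have finS: "finite S" using finA finite_subset by blast
    \<comment> \<open>The inner sum has at most one nonzero term, the one of the restriction of \<open>\<sigma>\<close> to \<open>S\<close>.\<close>
    have "of_int (sign p) * (prod (?b p) S * prod (?a p) (A - S)) =
        (if p = ?r S then if ?inv S then of_int (sign p) * (\<Prod>i\<in>S. - (x * \<epsilon> i)) else 0 else 0)"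
      if p: "p \<in> P" for p
    proof (cases "(\<forall>i\<in>S. p i = \<sigma> i) \<and> (\<forall>i\<in>A - S. p i = i)")
      case True
      then have r: "p = ?r S" and inv: "?inv S"
        using permutes_restriction_unique[OF \<sigma>A finA S, of p] p by (auto simp: P_def)
      have "\<sigma> ` S = S"
      proof -
        have "\<sigma> ` S \<subseteq> S" using inv by blast
        then show ?thesis using endo_inj_surj[OF finS] permutes_inj_on[OF \<sigma>A] by metis
      qed
      then have "(\<Prod>i\<in>S. - (x * \<epsilon> (\<sigma> i))) = (\<Prod>i\<in>S. - (x * \<epsilon> i))"
        using prod.reindex[OF permutes_inj_on[OF \<sigma>A, of S], of "\<lambda>i. - (x * \<epsilon> i)"] by simp
      moreover have "prod (?b p) S = (\<Prod>i\<in>S. - (x * \<epsilon> (\<sigma> i)))"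
        using True by (intro prod.cong) auto
      moreover have "prod (?a p) (A - S) = 1"
        using True by (intro prod.neutral) auto
      ultimately show ?thesis using r inv by simp
    next
      case False
      then have "prod (?b p) S * prod (?a p) (A - S) = 0"
        using finS finA by (auto simp: prod_zero_iff)
      moreover have "p \<noteq> ?r S"
      proof
        assume "p = ?r S"
        then have "\<forall>i\<in>S. p i = \<sigma> i" "\<forall>i\<in>A - S. p i = i"
          by (simp_all add: pointwise_power_def)
        with False show False by blast
      qed
      ultimately show ?thesis by (simp only: mult_zero_right if_False)
    qed
    then have "(\<Sum>p\<in>P. of_int (sign p) * (prod (?b p) S * prod (?a p) (A - S))) =
        (\<Sum>p\<in>P. if p = ?r S then if ?inv S then of_int (sign p) * (\<Prod>i\<in>S. - (x * \<epsilon> i)) else 0 else 0)"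
      by (intro sum.cong) auto
    also have "\<dots> = (if ?inv S then of_int (sign (?r S)) * (\<Prod>i\<in>S. - (x * \<epsilon> i)) else 0)"
      using finP pointwise_power_permutes[OF \<sigma>A finA, of "\<lambda>i. of_bool (i \<in> S)"]
      by (simp add: P_def)
    finally show "(\<Sum>p\<in>P. of_int (sign p) * (prod (?b p) S * prod (?a p) (A - S))) =
        (if ?inv S then of_int (sign (?r S)) * (\<Prod>i\<in>S. - (x * \<epsilon> i)) else 0)" .
  qed
  also have "\<dots> = (\<Sum>S | S \<subseteq> A \<and> ?inv S. of_int (sign (?r S)) * (\<Prod>i\<in>S. - (x * \<epsilon> i)))"
  proof -
    have eq: "{S. S \<subseteq> A \<and> ?inv S} = {S \<in> Pow A. ?inv S}" by simp
    have "finite (Pow A)" using finA by simp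
    then show ?thesis
      unfolding eq by (rule sum.inter_filter[symmetric])
  qed
  finally show ?thesis by (simp add: A_def W_def)
qed

section \<open>Colourings fixed by a permutation\<close>

text \<open>By induction on \<open>A\<close>: a permutation of \<open>insert a A\<close> is uniquely a permutation of \<open>A\<close> followed by
  the exchange of \<open>a\<close> with some \<open>b\<close>, possibly \<open>a\<close> itself, and it fixes \<open>f\<close> if and only if \<open>f b = f a\<close> and the
  permutation of \<open>A\<close> fixes \<open>f\<close> on \<open>A\<close>.\<close>

lemma card_colour_stabiliser:
  fixes f :: "'a \<Rightarrow> 'c"
  assumes "finite A" "finite C" "\<And>i. i \<in> A \<Longrightarrow> f i \<in> C"
  shows "card {\<sigma>. \<sigma> permutes A \<and> (\<forall>i\<in>A. f (\<sigma> i) = f i)} = (\<Prod>c\<in>C. fact (card {i\<in>A. f i = c}))"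
  using assms(1,3)
proof (induction A rule: finite_induct)
  case empty
  have "{\<sigma>. \<sigma> permutes ({} :: 'a set) \<and> (\<forall>i\<in>{}. f (\<sigma> i) = f i)} = {id}"
    by auto
  then show ?case by simp
next
  case (insert a A)
  let ?St = "\<lambda>A. {\<sigma>. \<sigma> permutes A \<and> (\<forall>i\<in>A. f (\<sigma> i) = f i)}"
  let ?B = "{b \<in> insert a A. f b = f a}"
  let ?g = "\<lambda>(b, p). Transposition.transpose a b \<circ> p"
  have stab: "(\<forall>i\<in>insert a A. f (Transposition.transpose a b (p i)) = f i) \<longleftrightarrow>
      f b = f a \<and> (\<forall>i\<in>A. f (p i) = f i)" if p: "p permutes A" for b p
  proof -
    have pa: "p a = a" using permutes_not_in[OF p] insert.hyps by blast
    show ?thesis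
    proof (cases "f b = f a")
      case True
      then have "f (Transposition.transpose a b i) = f i" for i
        by (simp add: Transposition.transpose_def)
      then show ?thesis using True pa by auto
    next
      case False
      then show ?thesis using pa by auto
    qed
  qed
  have image: "?St (insert a A) = ?g ` (?B \<times> ?St A)"
  proof (intro equalityI subsetI)
    fix \<sigma> assume "\<sigma> \<in> ?St (insert a A)"
    then have perm: "\<sigma> \<in> {p. p permutes insert a A}"
      and fix_f: "\<forall>i\<in>insert a A. f (\<sigma> i) = f i"
      by simp_all
    from perm obtain z where z: "z \<in> {(b, p). b \<in> insert a A \<and> p \<in> {p. p permutes A}}"
      and \<sigma>z: "\<sigma> = ?g z"
      unfolding permutes_insert by (rule imageE)
    obtain b p where bp: "z = (b, p)" by (cases z)
    have b: "b \<in> insert a A" and p: "p permutes A"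
      and \<sigma>: "\<sigma> = Transposition.transpose a b \<circ> p"
      using z \<sigma>z unfolding bp by simp_all
    from fix_f have "\<forall>i\<in>insert a A. f (Transposition.transpose a b (p i)) = f i"
      unfolding \<sigma> comp_apply .
    with b p have "(b, p) \<in> ?B \<times> ?St A"
      using stab[OF p] by simp
    then show "\<sigma> \<in> ?g ` (?B \<times> ?St A)"
      by (rule rev_image_eqI) (simp add: \<sigma>)
  next
    fix \<sigma> assume "\<sigma> \<in> ?g ` (?B \<times> ?St A)"
    then obtain z where z: "z \<in> ?B \<times> ?St A" and \<sigma>z: "\<sigma> = ?g z"
      by (rule imageE)
    obtain b p where bp: "z = (b, p)" by (cases z)
    have b: "b \<in> ?B" and p: "p permutes A" "\<forall>i\<in>A. f (p i) = f i"
      and \<sigma>: "\<sigma> = Transposition.transpose a b \<circ> p"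
      using z \<sigma>z unfolding bp by simp_all
    have "\<sigma> \<in> {p. p permutes insert a A}"
      unfolding permutes_insert
      by (rule image_eqI[of _ _ "(b, p)"]) (use \<sigma> p(1) b in simp_all)
    moreover have "\<forall>i\<in>insert a A. f (\<sigma> i) = f i"
      unfolding \<sigma> comp_apply using stab[OF p(1), of b] p(2) b by blast
    ultimately show "\<sigma> \<in> ?St (insert a A)"
      by simp
  qed
  have inj: "inj_on ?g (?B \<times> ?St A)"
  proof (rule inj_onI)
    fix u v
    assume uv: "u \<in> ?B \<times> ?St A" "v \<in> ?B \<times> ?St A" "?g u = ?g v"
    obtain b p c q where u: "u = (b, p)" and v: "v = (c, q)"
      by (cases u, cases v)
    have p: "p permutes A" and q: "q permutes A"
      and eq: "Transposition.transpose a b \<circ> p = Transposition.transpose a c \<circ> q"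
      using uv unfolding u v by simp_all
    have fixed: "p a = a" "q a = a"
      using permutes_not_in[OF p] permutes_not_in[OF q] insert.hyps by blast+
    have "b = c" using fun_cong[OF eq, of a] fixed by simp
    moreover have "p = q"
    proof
      fix i
      have "Transposition.transpose a b (p i) = Transposition.transpose a b (q i)"
        using fun_cong[OF eq, of i] \<open>b = c\<close> by simp
      then show "p i = q i"
        by (metis transpose_involutory)
    qed
    ultimately show "u = v" by (simp add: u v)
  qed
  have "card (?St (insert a A)) = card ?B * card (?St A)"
    unfolding image card_image[OF inj] card_cartesian_product ..
  also have "card ?B = Suc (card {i\<in>A. f i = f a})"
  proof -
    have "?B = insert a {i\<in>A. f i = f a}" by auto
    then show ?thesis using insert.hyps by simp
  qed
  also have "card (?St A) = fact (card {i\<in>A. f i = f a}) * (\<Prod>c\<in>C - {f a}. fact (card {i\<in>A. f i = c}))"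
    using insert assms(2) by (simp add: prod.remove[of C "f a"])
  also have "Suc (card {i\<in>A. f i = f a}) * \<dots> =
      fact (card {i\<in>insert a A. f i = f a}) * (\<Prod>c\<in>C - {f a}. fact (card {i\<in>insert a A. f i = c}))"
  proof -
    have "{i\<in>insert a A. f i = f a} = insert a {i\<in>A. f i = f a}" by auto
    then have "fact (card {i\<in>insert a A. f i = f a}) =
        Suc (card {i\<in>A. f i = f a}) * (fact (card {i\<in>A. f i = f a}) :: nat)"
      using insert.hyps by simp
    moreover have "(\<Prod>c\<in>C - {f a}. fact (card {i\<in>insert a A. f i = c}) :: nat) =
        (\<Prod>c\<in>C - {f a}. fact (card {i\<in>A. f i = c}))"
    proof (rule prod.cong[OF refl])
      fix c assume "c \<in> C - {f a}"
      then have "{i\<in>insert a A. f i = c} = {i\<in>A. f i = c}" by auto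
      then show "(fact (card {i\<in>insert a A. f i = c}) :: nat) = fact (card {i\<in>A. f i = c})"
        by simp
    qed
    ultimately show ?thesis by (simp only: mult.assoc)
  qed
  also have "\<dots> = (\<Prod>c\<in>C. fact (card {i\<in>insert a A. f i = c}))"
    using insert.prems assms(2) by (simp add: prod.remove[of C "f a"])
  finally show ?case .
qed

lemma inverse_one_minus_const_mult_X:
  fixes y :: "'a :: field"
  shows "inverse (1 - fps_const y * fps_X) = Abs_fps (\<lambda>n. y ^ n)"
proof (rule fps_inverse_unique)
  have "fps_const y * fps_X * Abs_fps (\<lambda>n. y ^ n) = Abs_fps (\<lambda>n. y ^ n) - 1"
    by (rule fps_ext) (simp add: mult.assoc power_eq_if)
  then show "(1 - fps_const y * fps_X) * Abs_fps (\<lambda>n. y ^ n) = 1"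
    by (simp add: left_diff_distrib)
qed

text \<open>By induction on the set of colours: removing a colour \<open>a\<close> with fibre \<open>S\<close> leaves a colouring of
  \<open>A - S\<close> by the other colours, and the number of sets \<open>S\<close> of size \<open>k\<close> turns the two factorials
  into \<open>fact (card A)\<close>.\<close>

lemma sum_fact_weighted_colourings:
  fixes Y :: "'c \<Rightarrow> 'b :: field_char_0"
  assumes "finite C" "finite A"
  shows "(\<Sum>f\<in>A \<rightarrow>\<^sub>E C. \<Prod>c\<in>C. fact (card {i\<in>A. f i = c}) * Y c ^ card {i\<in>A. f i = c}) =
    fact (card A) * fps_nth (\<Prod>c\<in>C. inverse (1 - fps_const (Y c) * fps_X)) (card A)"
  using assms
proof (induction C arbitrary: A rule: finite_induct)
  case empty
  show ?case
  proof (cases "A = {}")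
    case False
    then have "A \<rightarrow>\<^sub>E ({} :: 'c set) = {}" by (auto simp: PiE_eq_empty_iff)
    with False empty show ?thesis by simp
  qed simp
next
  case (insert a C)
  let ?k = "\<lambda>A f c. card {i\<in>A. f i = c}"
  let ?F = "\<lambda>A f c. fact (?k A f c) * Y c ^ ?k A f c :: 'b"
  let ?P = "\<Prod>c\<in>C. inverse (1 - fps_const (Y c) * fps_X)"
  let ?n = "card A"
  let ?u = "\<lambda>S. fact (card S) * Y a ^ card S :: 'b"
  have finPi: "finite (A \<rightarrow>\<^sub>E insert a C)"
    using insert by (intro finite_PiE) auto
  have fibre: "(\<Sum>f | f \<in> A \<rightarrow>\<^sub>E insert a C \<and> {i\<in>A. f i = a} = S. \<Prod>c\<in>insert a C. ?F A f c) =
      ?u S * (\<Sum>f\<in>(A - S) \<rightarrow>\<^sub>E C. \<Prod>c\<in>C. ?F (A - S) f c)" if S: "S \<subseteq> A" for S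
  proof -
    have "(\<Sum>f | f \<in> A \<rightarrow>\<^sub>E insert a C \<and> {i\<in>A. f i = a} = S. \<Prod>c\<in>insert a C. ?F A f c) =
        (\<Sum>f\<in>(A - S) \<rightarrow>\<^sub>E C. ?u S * (\<Prod>c\<in>C. ?F (A - S) f c))"
    proof (rule sum.reindex_bij_witness
        [where i = "\<lambda>f. \<lambda>i. if i \<in> S then a else f i" and j = "\<lambda>f. restrict f (A - S)"])
      fix f assume f: "f \<in> {f. f \<in> A \<rightarrow>\<^sub>E insert a C \<and> {i\<in>A. f i = a} = S}"
      then show "(\<lambda>i. if i \<in> S then a else restrict f (A - S) i) = f"
        by (auto simp: fun_eq_iff PiE_def extensional_def)
      show "restrict f (A - S) \<in> (A - S) \<rightarrow>\<^sub>E C"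
        using f by (auto simp: PiE_def Pi_def)
      have "(\<Prod>c\<in>C. ?F A f c) = (\<Prod>c\<in>C. ?F (A - S) (restrict f (A - S)) c)"
      proof (rule prod.cong[OF refl])
        fix c assume "c \<in> C"
        then have "{i\<in>A. f i = c} = {i\<in>A - S. restrict f (A - S) i = c}"
          using f insert.hyps by auto
        then show "?F A f c = ?F (A - S) (restrict f (A - S)) c" by (simp only:)
      qed
      then show "?u S * (\<Prod>c\<in>C. ?F (A - S) (restrict f (A - S)) c) = (\<Prod>c\<in>insert a C. ?F A f c)"
        using f insert.hyps by simp
    next
      fix f assume f: "f \<in> (A - S) \<rightarrow>\<^sub>E C"
      then show "restrict (\<lambda>i. if i \<in> S then a else f i) (A - S) = f"
        by (auto simp: fun_eq_iff PiE_def extensional_def)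
      show "(\<lambda>i. if i \<in> S then a else f i) \<in> {f. f \<in> A \<rightarrow>\<^sub>E insert a C \<and> {i\<in>A. f i = a} = S}"
        using f S insert.hyps by (auto simp: PiE_def extensional_def Pi_def)
    qed
    then show ?thesis by (simp add: sum_distrib_left)
  qed
  have "(\<Sum>f\<in>A \<rightarrow>\<^sub>E insert a C. \<Prod>c\<in>insert a C. ?F A f c) =
      (\<Sum>S\<in>Pow A. \<Sum>f | f \<in> A \<rightarrow>\<^sub>E insert a C \<and> {i\<in>A. f i = a} = S. \<Prod>c\<in>insert a C. ?F A f c)"
    using finPi insert.prems by (intro sum.group[symmetric]) auto
  also have "\<dots> = (\<Sum>S\<in>Pow A. ?u S * (fact (?n - card S) * fps_nth ?P (?n - card S)))"
  proof (rule sum.cong[OF refl])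
    fix S assume "S \<in> Pow A"
    then have S: "S \<subseteq> A" "card (A - S) = ?n - card S" "finite (A - S)"
      using insert.prems by (auto simp: card_Diff_subset finite_subset)
    show "(\<Sum>f | f \<in> A \<rightarrow>\<^sub>E insert a C \<and> {i\<in>A. f i = a} = S. \<Prod>c\<in>insert a C. ?F A f c) =
        ?u S * (fact (?n - card S) * fps_nth ?P (?n - card S))"
      unfolding fibre[OF S(1)] insert.IH[OF S(3)] S(2) ..
  qed
  also have "\<dots> = (\<Sum>k\<le>?n. \<Sum>S | S \<in> Pow A \<and> card S = k.
      ?u S * (fact (?n - card S) * fps_nth ?P (?n - card S)))"
    using insert.prems by (intro sum.group[symmetric]) (auto intro: card_mono)
  also have "\<dots> = (\<Sum>k\<le>?n. fact ?n * (Y a ^ k * fps_nth ?P (?n - k)))"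
  proof (rule sum.cong[OF refl])
    fix k assume k: "k \<in> {..?n}"
    have "(\<Sum>S | S \<in> Pow A \<and> card S = k. ?u S * (fact (?n - card S) * fps_nth ?P (?n - card S))) =
        (\<Sum>S | S \<in> Pow A \<and> card S = k. fact k * Y a ^ k * (fact (?n - k) * fps_nth ?P (?n - k)))"
      by (intro sum.cong) auto
    also have "\<dots> = of_nat (?n choose k) * (fact k * Y a ^ k * (fact (?n - k) * fps_nth ?P (?n - k)))"
      using insert.prems by (simp add: n_subsets)
    also have "\<dots> = (fact k * fact (?n - k) * of_nat (?n choose k)) * (Y a ^ k * fps_nth ?P (?n - k))"
      by (simp only: mult_ac)
    also have "fact k * fact (?n - k) * of_nat (?n choose k) = (fact ?n :: 'b)"
      using k binomial_fact_lemma[of k ?n]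
      by (metis atMost_iff of_nat_fact of_nat_mult)
    finally show "(\<Sum>S | S \<in> Pow A \<and> card S = k. ?u S * (fact (?n - card S) * fps_nth ?P (?n - card S))) =
        fact ?n * (Y a ^ k * fps_nth ?P (?n - k))" .
  qed
  also have "\<dots> = fact ?n * fps_nth (Abs_fps (\<lambda>k. Y a ^ k) * ?P) ?n"
    by (simp add: fps_mult_nth sum_distrib_left atMost_atLeast0)
  finally show ?case
    using insert.hyps by (simp add: inverse_one_minus_const_mult_X)
qed

text \<open>This is the expansion of a complete homogeneous symmetric polynomial in power sums: for fixed
  \<open>\<sigma>\<close>, the inner sum is the product, over the cycles of \<open>\<sigma>\<close>, of the power sums
  \<open>\<Sum>c\<in>C. Y c ^ l\<close>, with \<open>l\<close> the length of the cycle.\<close>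

lemma sum_permutations_fixed_colourings:
  fixes Y :: "'c \<Rightarrow> 'b :: field_char_0"
  assumes C: "finite C" and A: "finite A"
  shows "(\<Sum>\<sigma> | \<sigma> permutes A. \<Sum>f | f \<in> A \<rightarrow>\<^sub>E C \<and> (\<forall>i\<in>A. f (\<sigma> i) = f i). \<Prod>i\<in>A. Y (f i)) =
    fact (card A) * fps_nth (\<Prod>c\<in>C. inverse (1 - fps_const (Y c) * fps_X)) (card A)"
proof -
  have fin: "finite {\<sigma>. \<sigma> permutes A}" "finite (A \<rightarrow>\<^sub>E C)"
    using A C by (auto intro: finite_permutations finite_PiE)
  have "(\<Sum>\<sigma> | \<sigma> permutes A. \<Sum>f | f \<in> A \<rightarrow>\<^sub>E C \<and> (\<forall>i\<in>A. f (\<sigma> i) = f i). \<Prod>i\<in>A. Y (f i)) =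
      (\<Sum>f\<in>A \<rightarrow>\<^sub>E C. \<Sum>\<sigma> | \<sigma> \<in> {\<sigma>. \<sigma> permutes A} \<and> (\<forall>i\<in>A. f (\<sigma> i) = f i). \<Prod>i\<in>A. Y (f i))"
    using fin by (rule sum.swap_restrict)
  also have "\<dots> = (\<Sum>f\<in>A \<rightarrow>\<^sub>E C. \<Prod>c\<in>C. fact (card {i\<in>A. f i = c}) * Y c ^ card {i\<in>A. f i = c})"
  proof (rule sum.cong[OF refl])
    fix f assume f: "f \<in> A \<rightarrow>\<^sub>E C"
    then have im: "f ` A \<subseteq> C" by auto
    have "(\<Prod>i\<in>A. Y (f i)) = (\<Prod>c\<in>C. \<Prod>i | i \<in> A \<and> f i = c. Y (f i))"
      using prod.group[OF A C im, of "\<lambda>i. Y (f i)"] by simp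
    also have "\<dots> = (\<Prod>c\<in>C. Y c ^ card {i\<in>A. f i = c})"
      by (intro prod.cong refl) simp
    finally show "(\<Sum>\<sigma> | \<sigma> \<in> {\<sigma>. \<sigma> permutes A} \<and> (\<forall>i\<in>A. f (\<sigma> i) = f i). \<Prod>i\<in>A. Y (f i)) =
        (\<Prod>c\<in>C. fact (card {i\<in>A. f i = c}) * Y c ^ card {i\<in>A. f i = c})"
      using card_colour_stabiliser[OF A C, of f] im by (simp add: prod.distrib image_subset_iff)
  qed
  finally show ?thesis
    by (simp add: sum_fact_weighted_colourings[OF C A])
qed

section \<open>Averaging over the signs\<close>

text \<open>A family of invariant sets \<open>F j\<close>, for \<open>j \<in> J\<close>, is the same as an invariant colouring, which
  gives the index \<open>i\<close> the colour \<open>{j \<in> J. i \<in> F j}\<close>. The signs of the restrictions combine, since the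
  indicators of the \<open>F j\<close> add up to \<open>\<lambda>i. card (f i)\<close>.\<close>

lemma prod_char_poly_value_signed_permutation_matrix:
  fixes X :: "'j \<Rightarrow> complex"
  assumes \<sigma>: "\<sigma> permutes {0..<n}" and J: "finite J"
  shows "(\<Prod>j\<in>J. char_poly_value n (X j) (signed_permutation_matrix n \<epsilon> \<sigma>)) =
    (\<Sum>f | f \<in> {0..<n} \<rightarrow>\<^sub>E Pow J \<and> (\<forall>i\<in>{0..<n}. f (\<sigma> i) = f i).
      of_int (sign (pointwise_power \<sigma> (\<lambda>i. card (f i)))) * (\<Prod>i\<in>{0..<n}. \<Prod>j\<in>f i. - (X j * \<epsilon> i)))"
proof -
  define A where "A = {0..<n}"
  note \<sigma>A = \<sigma>[folded A_def]
  have A: "finite A" by (simp add: A_def)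
  let ?I = "{S. S \<subseteq> A \<and> (\<forall>i. (\<sigma> i \<in> S) = (i \<in> S))}"
  let ?r = "\<lambda>S. pointwise_power \<sigma> (\<lambda>i. of_bool (i \<in> S))"
  let ?h = "\<lambda>j S. of_int (sign (?r S)) * (\<Prod>i\<in>S. - (X j * \<epsilon> i))"
  let ?L = "{f. f \<in> A \<rightarrow>\<^sub>E Pow J \<and> (\<forall>i\<in>A. f (\<sigma> i) = f i)}"
  let ?t = "\<lambda>f. of_int (sign (pointwise_power \<sigma> (\<lambda>i. card (f i)))) * (\<Prod>i\<in>A. \<Prod>j\<in>f i. - (X j * \<epsilon> i)) :: complex"
  have finI: "finite ?I" using A by simp
  have "(\<Prod>j\<in>J. char_poly_value n (X j) (signed_permutation_matrix n \<epsilon> \<sigma>)) = (\<Prod>j\<in>J. \<Sum>S\<in>?I. ?h j S)"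
    by (simp add: char_poly_value_signed_permutation_matrix[OF \<sigma>] A_def)
  also have "\<dots> = (\<Sum>F\<in>J \<rightarrow>\<^sub>E ?I. \<Prod>j\<in>J. ?h j (F j))"
    using J finI by (rule prod_sum_PiE)
  also have "\<dots> = (\<Sum>f\<in>?L. ?t f)"
  proof (rule sum.reindex_bij_witness
      [where i = "\<lambda>f. \<lambda>j\<in>J. {i\<in>A. j \<in> f i}" and j = "\<lambda>F. \<lambda>i\<in>A. {j\<in>J. i \<in> F j}"])
    fix F assume F: "F \<in> J \<rightarrow>\<^sub>E ?I"
    let ?f = "\<lambda>i\<in>A. {j\<in>J. i \<in> F j}"
    have FA: "F j \<subseteq> A" and Finv: "\<And>i. (\<sigma> i \<in> F j) = (i \<in> F j)" if "j \<in> J" for j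
      using PiE_mem[OF F that] by simp_all
    show "(\<lambda>j\<in>J. {i\<in>A. j \<in> ?f i}) = F"
    proof
      fix j show "(\<lambda>j\<in>J. {i\<in>A. j \<in> ?f i}) j = F j"
        using F FA by (cases "j \<in> J") auto
    qed
    show "?f \<in> ?L"
      using Finv permutes_in_image[OF \<sigma>A] by auto
    \<comment> \<open>Off \<open>A\<close> the colouring is \<open>undefined\<close>; the exponent there is irrelevant, as \<open>\<sigma>\<close> fixes these points.\<close>
    have card_f: "pointwise_power \<sigma> (\<lambda>i. card (?f i)) = pointwise_power \<sigma> (\<lambda>i. \<Sum>j\<in>J. of_bool (i \<in> F j))"
    proof
      fix i
      have fixed: "(\<sigma> ^^ k) i = i" if "i \<notin> A" for k
        using permutes_not_in[OF funpow_permutes[OF \<sigma>A] that] .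
      have "card (?f i) = (\<Sum>j\<in>J. of_bool (i \<in> F j))" if "i \<in> A"
        using that J by (simp add: of_bool_def flip: sum.inter_filter)
      then show "pointwise_power \<sigma> (\<lambda>i. card (?f i)) i = pointwise_power \<sigma> (\<lambda>i. \<Sum>j\<in>J. of_bool (i \<in> F j)) i"
        using fixed by (cases "i \<in> A") (simp_all add: pointwise_power_def)
    qed
    have "sign (pointwise_power \<sigma> (\<lambda>i. card (?f i))) = (\<Prod>j\<in>J. sign (?r (F j)))"
      unfolding card_f using Finv by (intro sign_pointwise_power_sum[OF \<sigma>A A J]) simp
    moreover have "(\<Prod>j\<in>J. \<Prod>i\<in>F j. - (X j * \<epsilon> i)) = (\<Prod>i\<in>A. \<Prod>j\<in>?f i. - (X j * \<epsilon> i))"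
    proof -
      have "(\<Prod>j\<in>J. \<Prod>i\<in>F j. - (X j * \<epsilon> i)) = (\<Prod>j\<in>J. \<Prod>i | i \<in> A \<and> i \<in> F j. - (X j * \<epsilon> i))"
        using FA by (intro prod.cong refl) auto
      also have "\<dots> = (\<Prod>i\<in>A. \<Prod>j | j \<in> J \<and> i \<in> F j. - (X j * \<epsilon> i))"
        using J A by (rule prod.swap_restrict)
      also have "\<dots> = (\<Prod>i\<in>A. \<Prod>j\<in>?f i. - (X j * \<epsilon> i))"
        by (intro prod.cong) simp_all
      finally show ?thesis .
    qed
    ultimately show "?t ?f = (\<Prod>j\<in>J. ?h j (F j))"
      by (simp only: prod.distrib of_int_prod)
  next
    fix f assume "f \<in> ?L"
    then have f: "f \<in> A \<rightarrow>\<^sub>E Pow J" and finv: "\<And>i. i \<in> A \<Longrightarrow> f (\<sigma> i) = f i"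
      by simp_all
    have fJ: "f i \<subseteq> J" if "i \<in> A" for i
      using PiE_mem[OF f that] by simp
    let ?F = "\<lambda>j\<in>J. {i\<in>A. j \<in> f i}"
    show "(\<lambda>i\<in>A. {j\<in>J. i \<in> ?F j}) = f"
    proof
      fix i show "(\<lambda>i\<in>A. {j\<in>J. i \<in> ?F j}) i = f i"
        using f fJ by (cases "i \<in> A") auto
    qed
    show "?F \<in> J \<rightarrow>\<^sub>E ?I"
      using finv permutes_in_image[OF \<sigma>A] by auto
  qed
  finally show ?thesis by (simp add: A_def)
qed

lemma sum_signs_prod:
  fixes X :: "'j \<Rightarrow> complex"
  assumes A: "finite A"
  shows "(\<Sum>\<epsilon>\<in>A \<rightarrow>\<^sub>E {1, -1}. \<Prod>i\<in>A. \<Prod>j\<in>f i. - (X j * \<epsilon> i)) =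
    (if \<forall>i\<in>A. even (card (f i)) then 2 ^ card A * (\<Prod>i\<in>A. \<Prod>j\<in>f i. X j) else 0)"
proof -
  have pm: "(\<Prod>j\<in>f i. - (X j * 1)) + (\<Prod>j\<in>f i. - (X j * - 1)) =
      (if even (card (f i)) then 2 * (\<Prod>j\<in>f i. X j) else 0)" for i
    by (simp add: prod_uminus)
  have "(\<Sum>\<epsilon>\<in>A \<rightarrow>\<^sub>E {1, -1}. \<Prod>i\<in>A. \<Prod>j\<in>f i. - (X j * \<epsilon> i)) =
      (\<Prod>i\<in>A. \<Sum>e\<in>{1, -1}. \<Prod>j\<in>f i. - (X j * e))"
    using A by (subst prod_sum_PiE) auto
  also have "\<dots> = (\<Prod>i\<in>A. if even (card (f i)) then 2 * (\<Prod>j\<in>f i. X j) else 0)"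
    using pm by (intro prod.cong refl) simp
  also have "\<dots> = (if \<forall>i\<in>A. even (card (f i)) then 2 ^ card A * (\<Prod>i\<in>A. \<Prod>j\<in>f i. X j) else 0)"
    using A by (auto simp: prod.distrib prod_zero_iff)
  finally show ?thesis .
qed

lemma sum_hyperoctahedral_prod_char_poly_value:
  fixes X :: "'j \<Rightarrow> complex"
  assumes J: "finite J"
  shows "(\<Sum>\<sigma> | \<sigma> permutes {0..<n}. \<Sum>\<epsilon>\<in>{0..<n} \<rightarrow>\<^sub>E {1, -1}.
      \<Prod>j\<in>J. char_poly_value n (X j) (signed_permutation_matrix n \<epsilon> \<sigma>)) =
    2 ^ n * fact n *
      fps_nth (\<Prod>T | T \<subseteq> J \<and> even (card T). inverse (1 - fps_const (\<Prod>j\<in>T. X j) * fps_X)) n"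
proof -
  define A where "A = {0..<n}"
  have A: "finite A" "card A = n" by (simp_all add: A_def)
  let ?E = "{T. T \<subseteq> J \<and> even (card T)}"
  let ?Y = "\<lambda>T. \<Prod>j\<in>T. X j"
  have finE: "finite ?E" using J by simp
  have "(\<Sum>\<epsilon>\<in>A \<rightarrow>\<^sub>E {1, -1}. \<Prod>j\<in>J. char_poly_value n (X j) (signed_permutation_matrix n \<epsilon> \<sigma>)) =
      2 ^ n * (\<Sum>f | f \<in> A \<rightarrow>\<^sub>E ?E \<and> (\<forall>i\<in>A. f (\<sigma> i) = f i). \<Prod>i\<in>A. ?Y (f i))"
    if \<sigma>: "\<sigma> permutes A" for \<sigma>
  proof -
    let ?L = "{f. f \<in> A \<rightarrow>\<^sub>E Pow J \<and> (\<forall>i\<in>A. f (\<sigma> i) = f i)}"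
    let ?s = "\<lambda>f. of_int (sign (pointwise_power \<sigma> (\<lambda>i. card (f i)))) :: complex"
    have finL: "finite ?L"
      using A J by (intro finite_subset[OF _ finite_PiE[of A "\<lambda>_. Pow J"]]) auto
    have "(\<Sum>\<epsilon>\<in>A \<rightarrow>\<^sub>E {1, -1}. \<Prod>j\<in>J. char_poly_value n (X j) (signed_permutation_matrix n \<epsilon> \<sigma>)) =
        (\<Sum>\<epsilon>\<in>A \<rightarrow>\<^sub>E {1, -1}. \<Sum>f\<in>?L. ?s f * (\<Prod>i\<in>A. \<Prod>j\<in>f i. - (X j * \<epsilon> i)))"
      using prod_char_poly_value_signed_permutation_matrix[OF \<sigma>[unfolded A_def] J]
      by (simp add: A_def)
    also have "\<dots> = (\<Sum>f\<in>?L. \<Sum>\<epsilon>\<in>A \<rightarrow>\<^sub>E {1, -1}. ?s f * (\<Prod>i\<in>A. \<Prod>j\<in>f i. - (X j * \<epsilon> i)))"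
      by (rule sum.swap)
    also have "\<dots> = (\<Sum>f\<in>?L. if \<forall>i\<in>A. even (card (f i)) then 2 ^ n * (\<Prod>i\<in>A. ?Y (f i)) else 0)"
    proof (rule sum.cong[OF refl])
      fix f assume f: "f \<in> ?L"
      have inv: "card (f (\<sigma> i)) = card (f i)" for i
        using f permutes_not_in[OF \<sigma>, of i] by (cases "i \<in> A") auto
      have "?s f = 1" if "\<forall>i\<in>A. even (card (f i))"
        using sign_pointwise_power_even[OF \<sigma> A(1), of "\<lambda>i. card (f i)"] inv that by simp
      moreover have "(\<Sum>\<epsilon>\<in>A \<rightarrow>\<^sub>E {1, -1}. ?s f * (\<Prod>i\<in>A. \<Prod>j\<in>f i. - (X j * \<epsilon> i))) =
          ?s f * (if \<forall>i\<in>A. even (card (f i)) then 2 ^ n * (\<Prod>i\<in>A. ?Y (f i)) else 0)"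
        unfolding sum_distrib_left[symmetric] sum_signs_prod[OF A(1)] A(2) ..
      ultimately show "(\<Sum>\<epsilon>\<in>A \<rightarrow>\<^sub>E {1, -1}. ?s f * (\<Prod>i\<in>A. \<Prod>j\<in>f i. - (X j * \<epsilon> i))) =
          (if \<forall>i\<in>A. even (card (f i)) then 2 ^ n * (\<Prod>i\<in>A. ?Y (f i)) else 0)"
        by simp
    qed
    also have "\<dots> = (\<Sum>f | f \<in> ?L \<and> (\<forall>i\<in>A. even (card (f i))). 2 ^ n * (\<Prod>i\<in>A. ?Y (f i)))"
      by (rule sum.inter_filter[OF finL, symmetric])
    also have "{f. f \<in> ?L \<and> (\<forall>i\<in>A. even (card (f i)))} = {f. f \<in> A \<rightarrow>\<^sub>E ?E \<and> (\<forall>i\<in>A. f (\<sigma> i) = f i)}"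
      by (auto simp: PiE_iff)
    finally show ?thesis by (simp only: sum_distrib_left)
  qed
  then have "(\<Sum>\<sigma> | \<sigma> permutes A. \<Sum>\<epsilon>\<in>A \<rightarrow>\<^sub>E {1, -1}.
      \<Prod>j\<in>J. char_poly_value n (X j) (signed_permutation_matrix n \<epsilon> \<sigma>)) =
      2 ^ n * (\<Sum>\<sigma> | \<sigma> permutes A. \<Sum>f | f \<in> A \<rightarrow>\<^sub>E ?E \<and> (\<forall>i\<in>A. f (\<sigma> i) = f i). \<Prod>i\<in>A. ?Y (f i))"
    by (simp add: sum_distrib_left)
  also have "\<dots> = 2 ^ n * (fact n * fps_nth (\<Prod>T\<in>?E. inverse (1 - fps_const (?Y T) * fps_X)) n)"
    unfolding sum_permutations_fixed_colourings[OF finE A(1)] A(2) ..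
  finally show ?thesis by (simp add: A_def mult.assoc)
qed

section \<open>The hyperoctahedral group\<close>

lemma hyperoctahedral_group_eq_image:
  "hyperoctahedral_group n = (\<lambda>(\<sigma>, \<epsilon>). signed_permutation_matrix n \<epsilon> \<sigma>) `
    ({\<sigma>. \<sigma> permutes {0..<n}} \<times> ({0..<n} \<rightarrow>\<^sub>E {1, -1}))"
proof -
  have mult: "d * permutation_matrix n \<sigma> = signed_permutation_matrix n (\<lambda>i\<in>{0..<n}. d $$ (i, i)) \<sigma>"
    if d: "d \<in> sign_diagonal_matrices n" for d \<sigma>
  proof (rule eq_matI)
    have carrier: "d \<in> carrier_mat n n" "permutation_matrix n \<sigma> \<in> carrier_mat n n"
      using d by (simp_all add: sign_diagonal_matrices_def permutation_matrix_def)
    fix i j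
    assume "i < dim_row (signed_permutation_matrix n (\<lambda>i\<in>{0..<n}. d $$ (i, i)) \<sigma>)"
      "j < dim_col (signed_permutation_matrix n (\<lambda>i\<in>{0..<n}. d $$ (i, i)) \<sigma>)"
    then have ij: "i < n" "j < n" by (simp_all add: signed_permutation_matrix_def)
    have "(d * permutation_matrix n \<sigma>) $$ (i, j) = (\<Sum>k\<in>{0..<n}. d $$ (i, k) * permutation_matrix n \<sigma> $$ (k, j))"
      using ij carrier by (simp add: scalar_prod_def)
    also have "\<dots> = (\<Sum>k\<in>{0..<n}. if k = i then d $$ (i, i) * permutation_matrix n \<sigma> $$ (i, j) else 0)"
      using d ij by (intro sum.cong) (auto simp: sign_diagonal_matrices_def diagonal_mat_def)
    also have "\<dots> = signed_permutation_matrix n (\<lambda>i\<in>{0..<n}. d $$ (i, i)) \<sigma> $$ (i, j)"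
      using ij by (simp add: permutation_matrix_def signed_permutation_matrix_def)
    finally show "(d * permutation_matrix n \<sigma>) $$ (i, j) =
        signed_permutation_matrix n (\<lambda>i\<in>{0..<n}. d $$ (i, i)) \<sigma> $$ (i, j)" .
  qed (use d in \<open>auto simp: sign_diagonal_matrices_def permutation_matrix_def signed_permutation_matrix_def\<close>)
  show ?thesis
  proof (intro equalityI subsetI)
    fix w assume "w \<in> hyperoctahedral_group n"
    then obtain d \<sigma> where d: "d \<in> sign_diagonal_matrices n" and \<sigma>: "\<sigma> permutes {0..<n}"
      and w: "w = d * permutation_matrix n \<sigma>"
      by (auto simp: hyperoctahedral_group_def permutation_matrices_def)
    have "(\<lambda>i\<in>{0..<n}. d $$ (i, i)) \<in> {0..<n} \<rightarrow>\<^sub>E {1, -1}"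
      using d by (auto simp: sign_diagonal_matrices_def)
    with \<sigma> show "w \<in> (\<lambda>(\<sigma>, \<epsilon>). signed_permutation_matrix n \<epsilon> \<sigma>) `
        ({\<sigma>. \<sigma> permutes {0..<n}} \<times> ({0..<n} \<rightarrow>\<^sub>E {1, -1}))"
      unfolding w mult[OF d] by (intro image_eqI[of _ _ "(\<sigma>, \<lambda>i\<in>{0..<n}. d $$ (i, i))"]) simp_all
  next
    fix w assume "w \<in> (\<lambda>(\<sigma>, \<epsilon>). signed_permutation_matrix n \<epsilon> \<sigma>) `
        ({\<sigma>. \<sigma> permutes {0..<n}} \<times> ({0..<n} \<rightarrow>\<^sub>E {1, -1}))"
    then obtain z where z: "z \<in> {\<sigma>. \<sigma> permutes {0..<n}} \<times> ({0..<n} \<rightarrow>\<^sub>E {1, -1})"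
      and wz: "w = (\<lambda>(\<sigma>, \<epsilon>). signed_permutation_matrix n \<epsilon> \<sigma>) z"
      by (rule imageE)
    obtain \<sigma> \<epsilon> where \<sigma>\<epsilon>: "z = (\<sigma>, \<epsilon>)" by (cases z)
    have \<sigma>: "\<sigma> permutes {0..<n}" and \<epsilon>: "\<epsilon> \<in> {0..<n} \<rightarrow>\<^sub>E {1, -1}"
      and w: "w = signed_permutation_matrix n \<epsilon> \<sigma>"
      using z wz by (simp_all only: \<sigma>\<epsilon> mem_Sigma_iff mem_Collect_eq prod.case)
    let ?d = "mat n n (\<lambda>(i, j). if i = j then \<epsilon> i else 0)"
    have d: "?d \<in> sign_diagonal_matrices n"
      using \<epsilon> by (auto simp: sign_diagonal_matrices_def diagonal_mat_def PiE_iff)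
    have "(\<lambda>i\<in>{0..<n}. ?d $$ (i, i)) = \<epsilon>"
      using \<epsilon> by (auto simp: fun_eq_iff PiE_iff extensional_def)
    with mult[OF d, of \<sigma>] have "w = ?d * permutation_matrix n \<sigma>"
      unfolding w by simp
    with d \<sigma> show "w \<in> hyperoctahedral_group n"
      by (auto simp: hyperoctahedral_group_def permutation_matrices_def)
  qed
qed

lemma inj_on_signed_permutation_matrix:
  "inj_on (\<lambda>(\<sigma>, \<epsilon>). signed_permutation_matrix n \<epsilon> \<sigma>)
    ({\<sigma>. \<sigma> permutes {0..<n}} \<times> ({0..<n} \<rightarrow>\<^sub>E {1, -1}))"
proof (rule inj_onI, clarify)
  fix \<sigma> \<epsilon> \<sigma>' \<epsilon>'
  assume \<sigma>: "\<sigma> permutes {0..<n}" and \<epsilon>: "\<epsilon> \<in> {0..<n} \<rightarrow>\<^sub>E {1, -1}"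
    and \<sigma>': "\<sigma>' permutes {0..<n}" and \<epsilon>': "\<epsilon>' \<in> {0..<n} \<rightarrow>\<^sub>E {1, -1}"
    and eq: "signed_permutation_matrix n \<epsilon> \<sigma> = signed_permutation_matrix n \<epsilon>' \<sigma>'"
  have entry: "\<sigma> j = \<sigma>' j \<and> \<epsilon> (\<sigma> j) = \<epsilon>' (\<sigma> j)" if j: "j < n" for j
  proof -
    have \<sigma>j: "\<sigma> j < n" using permutes_in_image[OF \<sigma>, of j] j by simp
    then have "\<epsilon> (\<sigma> j) \<noteq> 0" using PiE_mem[OF \<epsilon>, of "\<sigma> j"] by auto
    moreover have "signed_permutation_matrix n \<epsilon> \<sigma> $$ (\<sigma> j, j) = \<epsilon> (\<sigma> j)"
      using \<sigma>j j by (simp add: signed_permutation_matrix_def)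
    moreover have "signed_permutation_matrix n \<epsilon>' \<sigma>' $$ (\<sigma> j, j) =
        (if \<sigma> j = \<sigma>' j then \<epsilon>' (\<sigma> j) else 0)"
      using \<sigma>j j by (simp add: signed_permutation_matrix_def)
    ultimately show ?thesis using eq by (simp split: if_splits)
  qed
  have "\<sigma> j = \<sigma>' j" for j
    using entry permutes_not_in[OF \<sigma>, of j] permutes_not_in[OF \<sigma>', of j] by (cases "j < n") auto
  moreover have "\<epsilon> = \<epsilon>'"
  proof (rule PiE_ext[OF \<epsilon> \<epsilon>'])
    fix i assume "i \<in> {0..<n}"
    then obtain j where "j < n" "i = \<sigma> j"
      using permutes_image[OF \<sigma>] by (metis atLeastLessThan_iff imageE)
    then show "\<epsilon> i = \<epsilon>' i" using entry by metis
  qed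
  ultimately show "\<sigma> = \<sigma>' \<and> \<epsilon> = \<epsilon>'" by auto
qed

lemma expectation_hyperoctahedral_prod_char_poly_value:
  fixes X :: "'j \<Rightarrow> complex"
  assumes J: "finite J"
  shows "measure_pmf.expectation (pmf_of_set (hyperoctahedral_group n))
      (\<lambda>w. \<Prod>j\<in>J. char_poly_value n (X j) w) =
    fps_nth (\<Prod>T | T \<subseteq> J \<and> even (card T). inverse (1 - fps_const (\<Prod>j\<in>T. X j) * fps_X)) n"
proof -
  let ?G = "hyperoctahedral_group n"
  let ?D = "{\<sigma>. \<sigma> permutes {0..<n}} \<times> ({0..<n} \<rightarrow>\<^sub>E {1, -1 :: complex})"
  let ?P = "\<Prod>T | T \<subseteq> J \<and> even (card T). inverse (1 - fps_const (\<Prod>j\<in>T. X j) * fps_X)"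
  have finD: "finite ?D"
    by (intro finite_cartesian_product finite_permutations finite_PiE) auto
  have cardD: "card ?D = fact n * 2 ^ n"
    by (simp add: card_cartesian_product card_permutations[of "{0..<n}" n] card_PiE
        card_insert_if numeral_2_eq_2[symmetric])
  have finG: "finite ?G" and cardG: "card ?G = fact n * 2 ^ n"
    using finD by (simp_all add: hyperoctahedral_group_eq_image card_image[OF inj_on_signed_permutation_matrix] cardD)
  have nonempty: "?G \<noteq> {}" using cardG by force
  have "(\<Sum>w\<in>?G. \<Prod>j\<in>J. char_poly_value n (X j) w) =
      (\<Sum>(\<sigma>, \<epsilon>)\<in>?D. \<Prod>j\<in>J. char_poly_value n (X j) (signed_permutation_matrix n \<epsilon> \<sigma>))"
    unfolding hyperoctahedral_group_eq_image
    by (subst sum.reindex[OF inj_on_signed_permutation_matrix]) (simp add: case_prod_unfold o_def)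
  also have "\<dots> = 2 ^ n * fact n * fps_nth ?P n"
    by (simp add: sum.cartesian_product[symmetric] sum_hyperoctahedral_prod_char_poly_value[OF J])
  finally have sum: "(\<Sum>w\<in>?G. \<Prod>j\<in>J. char_poly_value n (X j) w) = 2 ^ n * fact n * fps_nth ?P n" .
  have "measure_pmf.expectation (pmf_of_set ?G) (\<lambda>w. \<Prod>j\<in>J. char_poly_value n (X j) w) =
      (\<Sum>w\<in>?G. pmf (pmf_of_set ?G) w *\<^sub>R (\<Prod>j\<in>J. char_poly_value n (X j) w))"
    using finG nonempty by (intro integral_measure_pmf) auto
  also have "\<dots> = (1 / real (card ?G)) *\<^sub>R (\<Sum>w\<in>?G. \<Prod>j\<in>J. char_poly_value n (X j) w)"
    using finG nonempty by (simp add: scaleR_sum_right)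
  also have "\<dots> = fps_nth ?P n"
    unfolding sum cardG by (simp add: scaleR_conv_of_real)
  finally show ?thesis .
qed

section \<open>Grouping the factors by degree\<close>

text \<open>For \<open>k1\<close> and \<open>k2\<close> of the same parity, the exponent in \<^const>\<open>product_factor\<close> is minus the
  product of the binomial coefficients.\<close>

lemma product_factor_eq:
  assumes "even (int k1 - int k2)"
  shows "product_factor s1 s2 x1 x2 k1 k2 =
    inverse (1 - fps_const (x1 ^ k1 * x2 ^ k2) * fps_X) ^ ((s1 choose k1) * (s2 choose k2))"
proof -
  let ?b = "1 - fps_const (x1 ^ k1 * x2 ^ k2) * fps_X"
  let ?m = "(s1 choose k1) * (s2 choose k2)"
  have b0: "fps_nth ?b 0 \<noteq> 0" by simp
  then have "?b \<noteq> 0" by (metis fps_zero_nth)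
  then have "?b ^ ?m \<noteq> 0" by (rule power_not_zero)
  moreover have "inverse ?b ^ ?m * ?b ^ ?m = 1"
    unfolding power_mult_distrib[symmetric] inverse_mult_eq_1[OF b0] by simp
  ultimately show ?thesis
    using product_factor_times_base[OF assms, of s1 s2 x1 x2] mult_right_cancel by metis
qed

text \<open>A subset of the disjoint union with \<open>k1\<close> elements on the left and \<open>k2\<close> on the right contributes
  a factor that depends only on \<open>(k1, k2)\<close>, so the binomial coefficients appear as multiplicities.\<close>

lemma prod_even_subsets_Plus:
  fixes x1 x2 :: complex
  defines "X \<equiv> case_sum (\<lambda>_. x1) (\<lambda>_. x2)"
  shows "(\<Prod>T | T \<subseteq> {..<s1} <+> {..<s2} \<and> even (card T).
      inverse (1 - fps_const (\<Prod>j\<in>T. X j) * fps_X)) =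
    (\<Prod>(k1, k2)\<in>{..s1} \<times> {..s2}.
      if (2::int) dvd int k1 - int k2 then product_factor s1 s2 x1 x2 k1 k2 else 1)"
proof -
  let ?A = "{..<s1 :: nat}" and ?B = "{..<s2 :: nat}"
  let ?S = "{(T1, T2). T1 \<subseteq> ?A \<and> T2 \<subseteq> ?B \<and> even (card T1 + card T2)}"
  let ?b = "\<lambda>k1 k2. 1 - fps_const (x1 ^ k1 * x2 ^ k2) * fps_X"
  let ?g = "\<lambda>(T1, T2). (card T1, card T2)"
  have finS: "finite ?S"
    by (rule finite_subset[of _ "Pow ?A \<times> Pow ?B"]) auto
  have "(\<Prod>T | T \<subseteq> ?A <+> ?B \<and> even (card T). inverse (1 - fps_const (\<Prod>j\<in>T. X j) * fps_X)) =
      (\<Prod>(T1, T2)\<in>?S. inverse (?b (card T1) (card T2)))"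
  proof (rule prod.reindex_bij_witness
      [where i = "\<lambda>(T1, T2). T1 <+> T2" and j = "\<lambda>T. (Inl -` T, Inr -` T)"])
    fix T assume T: "T \<in> {T. T \<subseteq> ?A <+> ?B \<and> even (card T)}"
    have eq: "(Inl -` T) <+> (Inr -` T) = T"
    proof (rule Set.set_eqI)
      fix z show "z \<in> (Inl -` T) <+> (Inr -` T) \<longleftrightarrow> z \<in> T"
        by (cases z) auto
    qed
    then show "(case (Inl -` T, Inr -` T) of (T1, T2) \<Rightarrow> T1 <+> T2) = T" by simp
    have sub: "Inl -` T \<subseteq> ?A" "Inr -` T \<subseteq> ?B" using T by auto
    then have fin: "finite (Inl -` T)" "finite (Inr -` T)"
      by (auto intro: finite_subset)
    have card: "card T = card (Inl -` T) + card (Inr -` T)"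
      using card_Plus[OF fin] eq by simp
    then show "(Inl -` T, Inr -` T) \<in> ?S" using T sub by simp
    have "(\<Prod>j\<in>T. X j) = x1 ^ card (Inl -` T) * x2 ^ card (Inr -` T)"
      using prod.Plus[OF fin, of X] eq by (simp add: X_def)
    then show "(case (Inl -` T, Inr -` T) of (T1, T2) \<Rightarrow> inverse (?b (card T1) (card T2))) =
        inverse (1 - fps_const (\<Prod>j\<in>T. X j) * fps_X)"
      by simp
  next
    fix p assume "p \<in> ?S"
    then obtain T1 T2 where p: "p = (T1, T2)" and T: "T1 \<subseteq> ?A" "T2 \<subseteq> ?B" "even (card T1 + card T2)"
      by blast
    then have "finite T1" "finite T2"
      by (auto intro: finite_subset)
    then show "(case p of (T1, T2) \<Rightarrow> T1 <+> T2) \<in> {T. T \<subseteq> ?A <+> ?B \<and> even (card T)}"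
      using T by (auto simp: p card_Plus)
    show "(Inl -` (case p of (T1, T2) \<Rightarrow> T1 <+> T2), Inr -` (case p of (T1, T2) \<Rightarrow> T1 <+> T2)) = p"
      by (auto simp: p)
  qed
  also have "\<dots> = (\<Prod>k\<in>{..s1} \<times> {..s2}. \<Prod>p | p \<in> ?S \<and> ?g p = k. case p of (T1, T2) \<Rightarrow> inverse (?b (card T1) (card T2)))"
    using finS by (intro prod.group[symmetric]) (auto dest!: card_mono[rotated])
  also have "\<dots> = (\<Prod>(k1, k2)\<in>{..s1} \<times> {..s2}.
      if (2::int) dvd int k1 - int k2 then product_factor s1 s2 x1 x2 k1 k2 else 1)"
  proof (rule prod.cong[OF refl], clarify)
    fix k1 k2
    have parity: "(2::int) dvd int k1 - int k2 \<longleftrightarrow> even (k1 + k2)"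
      by simp
    let ?f = "\<lambda>p. case p of (T1, T2) \<Rightarrow> inverse (?b (card T1) (card T2))"
    let ?R = "{p. p \<in> ?S \<and> ?g p = (k1, k2)}"
    have "prod ?f ?R = (\<Prod>p\<in>?R. inverse (?b k1 k2))"
      by (intro prod.cong) auto
    then have const: "prod ?f ?R = inverse (?b k1 k2) ^ card ?R" by simp
    show "prod ?f ?R = (if (2::int) dvd int k1 - int k2 then product_factor s1 s2 x1 x2 k1 k2 else 1)"
    proof (cases "(2::int) dvd int k1 - int k2")
      case True
      then have "?R = {T1. T1 \<subseteq> ?A \<and> card T1 = k1} \<times> {T2. T2 \<subseteq> ?B \<and> card T2 = k2}"
        using parity by auto
      then have "card ?R = (s1 choose k1) * (s2 choose k2)"
        by (simp add: card_cartesian_product n_subsets)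
      then show ?thesis using True const product_factor_eq[OF True] by simp
    next
      case False
      then have "?R = {}" using parity by auto
      then have "prod ?f ?R = 1" by (simp only: prod.empty)
      then show ?thesis using False by simp
    qed
  qed
  finally show ?thesis .
qed

theorem mainTheorem6:
  fixes n s1 s2 :: nat and x1 x2 :: complex
  assumes "n \<ge> 1"
  shows "measure_pmf.expectation (pmf_of_set (hyperoctahedral_group n))
           (\<lambda>w. char_poly_value n x1 w ^ s1 * char_poly_value n x2 w ^ s2) =
         fps_nth (Prod_any (\<lambda>(k1, k2).
           if (2::int) dvd int k1 - int k2 then product_factor s1 s2 x1 x2 k1 k2 else 1)) n"
proof -
  let ?J = "{..<s1} <+> {..<s2}"
  let ?X = "case_sum (\<lambda>_. x1) (\<lambda>_. x2) :: nat + nat \<Rightarrow> complex"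
  let ?F = "\<lambda>(k1, k2). if (2::int) dvd int k1 - int k2 then product_factor s1 s2 x1 x2 k1 k2 else 1"
  have "{k. ?F k \<noteq> 1} \<subseteq> {..s1} \<times> {..s2}"
  proof clarify
    fix k1 k2
    assume *: "(if (2::int) dvd int k1 - int k2 then product_factor s1 s2 x1 x2 k1 k2 else 1) \<noteq> 1"
    have "(s1 choose k1) * (s2 choose k2) \<noteq> 0"
    proof
      assume "(s1 choose k1) * (s2 choose k2) = 0"
      then have "product_factor s1 s2 x1 x2 k1 k2 = 1" if "(2::int) dvd int k1 - int k2"
        unfolding product_factor_eq[OF that] by (simp only: power_0)
      with * show False by argo
    qed
    then show "k1 \<in> {..s1} \<and> k2 \<in> {..s2}"
      by (metis atMost_iff binomial_eq_0 linorder_not_le mult_is_0)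
  qed
  then have "Prod_any ?F = prod ?F ({..s1} \<times> {..s2})"
    by (intro Prod_any.expand_superset) auto
  moreover have "char_poly_value n x1 w ^ s1 * char_poly_value n x2 w ^ s2 =
      (\<Prod>j\<in>?J. char_poly_value n (?X j) w)" for w
    by (subst prod.Plus) simp_all
  ultimately show ?thesis
    using expectation_hyperoctahedral_prod_char_poly_value[of ?J n ?X]
    by (simp only: prod_even_subsets_Plus finite_Plus finite_lessThan)
qed

end
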